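(* For a Planted Partition Model with parameters $p_{\mathrm{in}},p_{\mathrm{out}}\in(0,1)$ and a community partition drawn from $\mathbf{CG}_{n,p}$, maximising the Bayesian posterior probability is equivalent to maximising ER-modularity with resolution parameter $$\gamma(p_{\mathrm{in}},p_{\mathrm{out}},p)=\frac{\log\left(\frac{1-p_{\mathrm{out}}}{1-p_{\mathrm{in}}}\cdot\frac{1-p}{p}\right)}{\log\left(\frac{p_{\mathrm{in}}(1-p_{\mathrm{out}})}{p_{\mathrm{out}}(1-p_{\mathrm{in}})}\right)}.$$
   Context: A cluster graph is a simple undirected graph on the labelled vertex set $\{1,\dots,n\}$ every connected component of which is a complete graph; it encodes a partition of the vertices into communities (the vertex sets of its components). For $p\in(0,1)$, $\mathbf{CG}_{n,p}$ is the Erdős–Rényi random graph on $n$ vertices with edge probability $p$, conditioned on the event that it is a cluster graph. Planted Partition Model: given a community partition $G_C$, a random graph on $\{1,\dots,n\}$ is generated by connecting every pair of vertices independently, with probability $p_{\mathrm{in}}$ if the two vertices are in the same community and with probability $p_{\mathrm{out}}$ if they are in different communities. For an observed simple graph $G$ on $\{1,\dots,n\}$, $\mathrm{Likelihood}(G_C;G)$ is the probability that this model with partition $G_C$ produces $G$, $\mathrm{Prior}(G_C)=\mathbb{P}(\mathbf{CG}_{n,p}=G_C)$, and the Bayesian posterior probability is $\mathrm{BayesPosterior}(G_C;G)=\mathrm{Likelihood}(G_C;G)\cdot\mathrm{Prior}(G_C)$ (up to a normalisation not depending on $G_C$). Writing $m(H)$ for the number of edges of $H$ and $G\cap G_C$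 for the graph whose edge set is the intersection of the edge sets of $G$ and $G_C$, the ER-modularity of $G_C$ with resolution parameter $\gamma$ is $$\mathrm{ERM}(G_C;G,\gamma)=\frac{1}{m(G)}\left(m(G\cap G_C)-\gamma\, m(G_C)\right).$$ Both maximisations are over all cluster graphs $G_C$ on $\{1,\dots,n\}$, for a fixed observed graph $G$ and known parameters $p_{\mathrm{in}},p_{\mathrm{out}}$.
   Formalization: The formal theorem assumes p_out < p_in (at equality the resolution parameter is undefined; for p_in < p_out maximising the posterior means minimising ER-modularity, so the claim fails) and that the observed graph G has at least one edge, since ER-modularity divides by m(G). *)

theory Defs
  imports "HOL-Probability.Probability" "HOL-Probability.Product_PMF"
begin

text \<open>
  A simple undirected graph on the labelled vertex set \<open>{1..n}\<close> is given by its edge set,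
  a set of two-element subsets of \<open>{1..n}\<close>.
\<close>

definition vertex_pairs :: "nat \<Rightarrow> nat set set" where
  "vertex_pairs n = {e. e \<subseteq> {1..n} \<and> card e = 2}"

definition simple_graph :: "nat \<Rightarrow> nat set set \<Rightarrow> bool" where
  "simple_graph n E \<longleftrightarrow> E \<subseteq> vertex_pairs n"

definition component_of_vertex :: "nat \<Rightarrow> nat set set \<Rightarrow> nat \<Rightarrow> nat set" where
  "component_of_vertex n E u = {v \<in> {1..n}. (u, v) \<in> {(a, b). {a, b} \<in> E}\<^sup>*}"

text \<open>The vertex sets of the connected components; for a cluster graph, its communities.\<close>

definition graph_components :: "nat \<Rightarrow> nat set set \<Rightarrow> nat set set" where
  "graph_components n E = component_of_vertex n E ` {1..n}"

definition cluster_graph :: "nat \<Rightarrow> nat set set \<Rightarrow> bool" where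
  "cluster_graph n E \<longleftrightarrow> simple_graph n E \<and>
     (\<forall>K \<in> graph_components n E. \<forall>u \<in> K. \<forall>v \<in> K. u \<noteq> v \<longrightarrow> {u, v} \<in> E)"

text \<open>
  The random graph in which every pair \<open>e\<close> is an edge independently with probability \<open>q e\<close>.
  The argument \<open>False\<close> of \<^const>\<open>Pi_pmf\<close> is only the default value outside of
  \<open>vertex_pairs n\<close>.
\<close>

definition independent_edges_graph :: "nat \<Rightarrow> (nat set \<Rightarrow> real) \<Rightarrow> nat set set pmf" where
  "independent_edges_graph n q =
     map_pmf (\<lambda>f. {e \<in> vertex_pairs n. f e})
       (Pi_pmf (vertex_pairs n) False (\<lambda>e. bernoulli_pmf (q e)))"

definition Erdos_Renyi :: "nat \<Rightarrow> real \<Rightarrow> nat set set pmf" where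
  "Erdos_Renyi n p = independent_edges_graph n (\<lambda>_. p)"

text \<open>
  For \<open>0 < p < 1\<close> the conditioning event has positive probability, as
  \<^const>\<open>cond_pmf\<close> requires.
\<close>

definition CG :: "nat \<Rightarrow> real \<Rightarrow> nat set set pmf" where
  "CG n p = cond_pmf (Erdos_Renyi n p) {E. cluster_graph n E}"

definition planted_partition :: "nat \<Rightarrow> real \<Rightarrow> real \<Rightarrow> nat set set \<Rightarrow> nat set set pmf" where
  "planted_partition n p_in p_out C =
     independent_edges_graph n (\<lambda>e. if \<exists>K \<in> graph_components n C. e \<subseteq> K then p_in else p_out)"

definition likelihood :: "nat \<Rightarrow> real \<Rightarrow> real \<Rightarrow> nat set set \<Rightarrow> nat set set \<Rightarrow> real" where
  "likelihood n p_in p_out C G = pmf (planted_partition n p_in p_out C) G"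

definition prior :: "nat \<Rightarrow> real \<Rightarrow> nat set set \<Rightarrow> real" where
  "prior n p C = pmf (CG n p) C"

text \<open>The posterior probability up to the normalisation, which does not depend on \<open>C\<close>.\<close>

definition Bayes_posterior ::
  "nat \<Rightarrow> real \<Rightarrow> real \<Rightarrow> real \<Rightarrow> nat set set \<Rightarrow> nat set set \<Rightarrow> real" where
  "Bayes_posterior n p_in p_out p C G = likelihood n p_in p_out C G * prior n p C"

definition ER_modularity :: "nat set set \<Rightarrow> nat set set \<Rightarrow> real \<Rightarrow> real" where
  "ER_modularity C G \<gamma> =
     1 / real (card G) * (real (card (G \<inter> C)) - \<gamma> * real (card C))"

definition resolution :: "real \<Rightarrow> real \<Rightarrow> real \<Rightarrow> real" where
  "resolution p_in p_out p =
     ln ((1 - p_out) / (1 - p_in) * ((1 - p) / p)) /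
     ln (p_in * (1 - p_out) / (p_out * (1 - p_in)))"

end

theory Submission
  imports Defs
begin

text \<open>
  Up to normalisation, the posterior of a cluster graph is a product over all vertex pairs. Dividing
  by the product belonging to the empty partition, a pair in \<open>C \<inter> G\<close> contributes \<open>exp (L * (1 - \<gamma>))\<close>,
  a pair in \<open>C - G\<close> contributes \<open>exp (- L * \<gamma>)\<close> and every other pair contributes \<open>1\<close>, where
  \<open>L = ln (p_in * (1 - p_out) / (p_out * (1 - p_in)))\<close> and \<open>\<gamma>\<close> is the resolution. Hence the
  posterior is a positive constant times the exponential of \<open>L * card G\<close> times the ER-modularity,
  and \<open>L > 0\<close> because \<open>p_out < p_in\<close>.
\<close>

lemma finite_vertex_pairs [simp]: "finite (vertex_pairs n)"
  unfolding vertex_pairs_def by (rule finite_subset[of _ "Pow {1..n}"]) auto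

lemma cluster_graph_subset: "cluster_graph n C \<Longrightarrow> C \<subseteq> vertex_pairs n"
  by (simp add: cluster_graph_def simple_graph_def)

text \<open>One direction is completeness of the components, the other holds since an edge is a path
  of length one. This turns the community test in \<open>planted_partition\<close> into membership
  in \<open>C\<close>.\<close>

lemma ex_component_superset_iff:
  assumes C: "cluster_graph n C" and e: "e \<in> vertex_pairs n"
  shows "(\<exists>K \<in> graph_components n C. e \<subseteq> K) \<longleftrightarrow> e \<in> C"
proof -
  from e obtain u v where uv: "e = {u, v}" "u \<noteq> v" "u \<in> {1..n}" "v \<in> {1..n}"
    unfolding vertex_pairs_def by (auto simp: card_2_iff)
  show ?thesis
  proof
    assume "\<exists>K \<in> graph_components n C. e \<subseteq> K"
    then show "e \<in> C" using C uv unfolding cluster_graph_def by blast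
  next
    assume "e \<in> C"
    then have "(u, v) \<in> {(a, b). {a, b} \<in> C}\<^sup>*" using uv by auto
    then have "e \<subseteq> component_of_vertex n C u"
      using uv by (auto simp: component_of_vertex_def)
    then show "\<exists>K \<in> graph_components n C. e \<subseteq> K"
      using uv unfolding graph_components_def by blast
  qed
qed

lemma pmf_independent_edges_graph:
  assumes q: "\<And>e. e \<in> vertex_pairs n \<Longrightarrow> 0 \<le> q e \<and> q e \<le> 1" and G: "G \<subseteq> vertex_pairs n"
  shows "pmf (independent_edges_graph n q) G =
         (\<Prod>e\<in>vertex_pairs n. if e \<in> G then q e else 1 - q e)"
proof -
  let ?V = "vertex_pairs n"
  let ?M = "Pi_pmf ?V False (\<lambda>e. bernoulli_pmf (q e))"
  have "pmf (independent_edges_graph n q) G = measure ?M ((\<lambda>f. {e \<in> ?V. f e}) -` {G})"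
    unfolding independent_edges_graph_def pmf_map ..
  also have "\<dots> = measure ?M {\<lambda>e. e \<in> G}"
  \<comment> \<open>The preimage of \<open>{G}\<close> also contains functions that are true
    somewhere outside \<open>?V\<close>. The default value \<open>False\<close> makes these null, so
    the two events agree on the support.\<close>
  proof (rule measure_pmf.finite_measure_eq_AE)
    have "(f \<in> (\<lambda>f. {e \<in> ?V. f e}) -` {G}) = (f \<in> {\<lambda>e. e \<in> G})" if "f \<in> set_pmf ?M" for f
    proof -
      have "f e = False" if "e \<notin> ?V" for e
        using that set_Pi_pmf_subset[of ?V False "\<lambda>e. bernoulli_pmf (q e)"] \<open>f \<in> set_pmf ?M\<close>
        by fastforce
      then show ?thesis using G by (auto simp: fun_eq_iff)
    qed
    then show "AE f in ?M. (f \<in> (\<lambda>f. {e \<in> ?V. f e}) -` {G}) = (f \<in> {\<lambda>e. e \<in> G})"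
      by (simp add: AE_measure_pmf_iff)
  qed auto
  also have "\<dots> = pmf ?M (\<lambda>e. e \<in> G)"
    by (simp add: measure_pmf_single)
  also have "\<dots> = (\<Prod>e\<in>?V. pmf (bernoulli_pmf (q e)) (e \<in> G))"
    using G by (intro pmf_Pi') auto
  also have "\<dots> = (\<Prod>e\<in>?V. if e \<in> G then q e else 1 - q e)"
    using q by (intro prod.cong) auto
  finally show ?thesis .
qed

lemma likelihood_cluster_graph:
  assumes "0 \<le> p_in" "p_in \<le> 1" "0 \<le> p_out" "p_out \<le> 1"
    and C: "cluster_graph n C" and G: "G \<subseteq> vertex_pairs n"
  shows "likelihood n p_in p_out C G =
         (\<Prod>e\<in>vertex_pairs n. if e \<in> G then (if e \<in> C then p_in else p_out)
                              else 1 - (if e \<in> C then p_in else p_out))"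
  unfolding likelihood_def planted_partition_def
  using assms by (subst pmf_independent_edges_graph) (auto intro!: prod.cong simp: ex_component_superset_iff)

lemma pmf_Erdos_Renyi:
  assumes "0 \<le> p" "p \<le> 1" "C \<subseteq> vertex_pairs n"
  shows "pmf (Erdos_Renyi n p) C = (\<Prod>e\<in>vertex_pairs n. if e \<in> C then p else 1 - p)"
  unfolding Erdos_Renyi_def using assms by (simp add: pmf_independent_edges_graph)

text \<open>Conditioning only divides by \<open>Z\<close>, which is the same for all cluster graphs.
  It is positive because \<open>C\<close> itself has positive probability.\<close>

lemma prior_cluster_graph:
  assumes p: "0 < p" "p < 1" and C: "cluster_graph n C"
  defines "Z \<equiv> measure (Erdos_Renyi n p) {E. cluster_graph n E}"
  shows "0 < Z" and "prior n p C = (\<Prod>e\<in>vertex_pairs n. if e \<in> C then p else 1 - p) / Z"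
proof -
  have ER: "pmf (Erdos_Renyi n p) C = (\<Prod>e\<in>vertex_pairs n. if e \<in> C then p else 1 - p)"
    using p C by (intro pmf_Erdos_Renyi cluster_graph_subset) auto
  also have "\<dots> > 0" using p by (intro prod_pos) auto
  finally have C_set: "C \<in> set_pmf (Erdos_Renyi n p)"
    by (simp add: set_pmf_iff)
  with C have ne: "set_pmf (Erdos_Renyi n p) \<inter> {E. cluster_graph n E} \<noteq> {}" by blast
  show "0 < Z" unfolding Z_def using C C_set by (intro measure_pmf_posI) auto
  show "prior n p C = (\<Prod>e\<in>vertex_pairs n. if e \<in> C then p else 1 - p) / Z"
    unfolding prior_def CG_def Z_def pmf_cond[OF ne] using C ER by simp
qed

text \<open>Since \<open>L\<close> is the denominator of the resolution, multiplying by
  \<open>L\<close> leaves only the numerator; both exponentials then become rational expressions in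
  the parameters.\<close>

lemma exp_mult_resolution:
  fixes p p_in p_out :: real
  assumes "0 < p" "p < 1" "0 < p_in" "p_in < 1" "0 < p_out" "p_out < 1" "p_out < p_in"
  defines "L \<equiv> ln (p_in * (1 - p_out) / (p_out * (1 - p_in)))"
  shows "0 < L"
    and "exp L = p_in * (1 - p_out) / (p_out * (1 - p_in))"
    and "exp (L * resolution p_in p_out p) = (1 - p_out) / (1 - p_in) * ((1 - p) / p)"
proof -
  have "p_out * (1 - p_in) < p_in * (1 - p_out)"
    using assms by (simp add: algebra_simps)
  moreover have "0 < p_out * (1 - p_in)" using assms by simp
  ultimately have gt1: "1 < p_in * (1 - p_out) / (p_out * (1 - p_in))" by simp
  then show L: "0 < L" unfolding L_def by (rule ln_gt_zero)
  from gt1 show "exp L = p_in * (1 - p_out) / (p_out * (1 - p_in))"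
    unfolding L_def by simp
  have "L * resolution p_in p_out p = ln ((1 - p_out) / (1 - p_in) * ((1 - p) / p))"
    using L unfolding resolution_def L_def[symmetric] by simp
  then show "exp (L * resolution p_in p_out p) = (1 - p_out) / (1 - p_in) * ((1 - p) / p)"
    using assms by simp
qed

text \<open>The constant \<open>A\<close>, the posterior value of the edgeless partition, does not
  depend on \<open>C\<close>.\<close>

lemma Bayes_posterior_eq_exp_ER_modularity:
  fixes p p_in p_out :: real
  assumes par: "0 < p" "p < 1" "0 < p_in" "p_in < 1" "0 < p_out" "p_out < 1" "p_out < p_in"
    and G: "simple_graph n G" "G \<noteq> {}" and C: "cluster_graph n C"
  defines "L \<equiv> ln (p_in * (1 - p_out) / (p_out * (1 - p_in)))"
    and "A \<equiv> (\<Prod>e\<in>vertex_pairs n. (if e \<in> G then p_out else 1 - p_out) * (1 - p)) /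
              measure (Erdos_Renyi n p) {E. cluster_graph n E}"
  shows "0 < A"
    and "Bayes_posterior n p_in p_out p C G =
         A * exp (L * real (card G) * ER_modularity C G (resolution p_in p_out p))"
proof -
  let ?V = "vertex_pairs n"
  let ?Z = "measure (Erdos_Renyi n p) {E. cluster_graph n E}"
  let ?r = "resolution p_in p_out p"
  \<comment> \<open>The share of the pair \<open>e\<close> in
    \<open>card (G \<inter> C) - ?r * card C\<close>.\<close>
  let ?w = "\<lambda>e. of_bool (e \<in> G \<inter> C) - ?r * of_bool (e \<in> C)"
  note Z = prior_cluster_graph[OF par(1,2) C]
  note L = exp_mult_resolution[OF par, folded L_def]
  have CV: "C \<subseteq> ?V" using C by (rule cluster_graph_subset)
  have GV: "G \<subseteq> ?V" using G by (simp add: simple_graph_def)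
  then have "finite G" by (rule finite_subset) simp
  with G have G0: "card G \<noteq> 0" by simp
  show "0 < A"
    unfolding A_def using Z(1) par by (intro divide_pos_pos prod_pos) auto
  have sum_w: "(\<Sum>e\<in>?V. ?w e) = real (card G) * ER_modularity C G ?r"
  proof -
    have "(\<Sum>e\<in>?V. ?w e) = real (card (?V \<inter> (G \<inter> C))) - ?r * real (card (?V \<inter> C))"
      by (simp add: sum_subtractf sum_distrib_left[symmetric] sum_of_bool_eq Int_def)
    moreover have "?V \<inter> (G \<inter> C) = G \<inter> C" "?V \<inter> C = C" using CV by auto
    ultimately show ?thesis using G0 by (simp only: ER_modularity_def) simp
  qed
  \<comment> \<open>Pairs outside \<open>C\<close> have \<open>?w e = 0\<close>; for pairs in
    \<open>C\<close> the exponential is the odds ratio against the edgeless partition.\<close>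
  have factor: "(if e \<in> G then (if e \<in> C then p_in else p_out)
           else 1 - (if e \<in> C then p_in else p_out)) * (if e \<in> C then p else 1 - p) =
        (if e \<in> G then p_out else 1 - p_out) * (1 - p) * exp (L * ?w e)" for e
  proof (cases "e \<in> C")
    case True
    have "exp (L * ?w e) = exp (L * of_bool (e \<in> G)) / exp (L * ?r)"
      using True by (simp add: right_diff_distrib exp_diff)
    also have "\<dots> = (if e \<in> G then p_in * (1 - p_out) / (p_out * (1 - p_in)) else 1) /
        ((1 - p_out) / (1 - p_in) * ((1 - p) / p))"
      by (simp add: L(2,3))
    finally show ?thesis
      using True par by simp
  qed simp
  have "Bayes_posterior n p_in p_out p C G =
      (\<Prod>e\<in>?V. (if e \<in> G then p_out else 1 - p_out) * (1 - p) * exp (L * ?w e)) / ?Z"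
    unfolding Bayes_posterior_def Z(2) factor[symmetric]
    using par C GV by (subst likelihood_cluster_graph) (auto simp: prod.distrib)
  also have "\<dots> = A * exp (L * (\<Sum>e\<in>?V. ?w e))"
    by (simp add: A_def prod.distrib exp_sum sum_distrib_left)
  finally show "Bayes_posterior n p_in p_out p C G =
      A * exp (L * real (card G) * ER_modularity C G ?r)"
    by (simp only: sum_w mult.assoc)
qed

text \<open>\<open>is_arg_max\<close> only asks that no admissible value be strictly larger, so it
  depends on the strict order alone.\<close>

lemma is_arg_max_cong_less:
  fixes f :: "'a \<Rightarrow> 'b::order" and g :: "'a \<Rightarrow> 'c::order"
  assumes "\<And>x y. P x \<Longrightarrow> P y \<Longrightarrow> f x < f y \<longleftrightarrow> g x < g y"
  shows "is_arg_max f P x \<longleftrightarrow> is_arg_max g P x"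
  using assms unfolding is_arg_max_def by blast

theorem theorem1p8:
  fixes n :: nat and p p_in p_out :: real and G :: "nat set set"
  assumes "0 < p" and "p < 1"
    and "0 < p_in" and "p_in < 1"
    and "0 < p_out" and "p_out < 1"
    and "p_out < p_in"
    and "simple_graph n G" and "G \<noteq> {}"
  shows "{C. is_arg_max (\<lambda>C. Bayes_posterior n p_in p_out p C G) (cluster_graph n) C} =
         {C. is_arg_max (\<lambda>C. ER_modularity C G (resolution p_in p_out p)) (cluster_graph n) C}"
proof (intro Collect_cong is_arg_max_cong_less)
  fix C D
  assume C: "cluster_graph n C" and D: "cluster_graph n D"
  have "finite G"
    using assms(8) finite_subset[OF _ finite_vertex_pairs] by (auto simp: simple_graph_def)
  with assms(9) have "0 < card G" by (simp add: card_gt_0_iff)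
  then have "0 < ln (p_in * (1 - p_out) / (p_out * (1 - p_in))) * real (card G)"
    using exp_mult_resolution(1)[OF assms(1-7)] by simp
  \<comment> \<open>Both posteriors carry the same positive factor, which cancels;
    \<open>exp\<close> and the positive multiplier in the exponent preserve the strict
    order.\<close>
  then show "Bayes_posterior n p_in p_out p C G < Bayes_posterior n p_in p_out p D G \<longleftrightarrow>
      ER_modularity C G (resolution p_in p_out p) < ER_modularity D G (resolution p_in p_out p)"
    using Bayes_posterior_eq_exp_ER_modularity(1)[OF assms C]
    unfolding Bayes_posterior_eq_exp_ER_modularity(2)[OF assms C]
      Bayes_posterior_eq_exp_ER_modularity(2)[OF assms D]
    by (simp only: mult_less_cancel_left_pos exp_less_cancel_iff)
qed

end
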